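(* Let $Y$ be a generalized truncation of a multigraph $X$. Then $Y$ is connected if and only if the projection of $Y$ into $\hat{X}$ is connected.
   Context: A multigraph may have multiple edges but no loops; it is assumed to have no isolated vertices. Generalized truncation: take a matching $M_0$ with $|M_0|=|E(X)|$ (on $2|E(X)|$ new vertices) and a bijection $F:E(X)\to M_0$; for each edge $e$ of $X$ with ends $u,v$, label one end of $F(e)$ by $u$ and the other by $v$. For $v\in V(X)$, the cluster $\mathrm{cl}(v)$ is the set of vertices labelled $v$; insert an arbitrary graph $\mathrm{con}(v)$ (constituent) on $\mathrm{cl}(v)$. The graph $Y=F(M_0)\cup\bigcup_v\mathrm{con}(v)$ is a generalized truncation of $X$. The auxiliary graph $\hat{X}$: its vertices are the edges of $F(M_0)$ (equivalently, obtained by contracting each edge of $F(M_0)$ to a vertex), each labelled by the 2-set $\{u,v\}$ of labels of the ends of that edge; two distinct vertices of $\hat{X}$ are adjacent iff their label sets have nonempty intersection. The projection of $Y$ into $\hat{X}$ is the spanning subgraph of $\hat{X}$ in which two vertices (i.e. two edges $f,g$ of $F(M_0)$) are adjacent iff $Y$ has an edge joining an end of $f$ to an end of $g$. *)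

theory Defs
  imports "Graph_Theory.Digraph_Component" "HOL-Library.Disjoint_Sets"
begin

record ('v, 'e) multigraph =
  mverts :: "'v set"
  medges :: "'e set"
  ends :: "'e \<Rightarrow> 'v set"

text \<open>Undirected, without loops (every edge has exactly two ends) and without isolated vertices.\<close>

locale multigraph =
  fixes X :: "('v, 'e) multigraph"
  assumes ends_subset: "e \<in> medges X \<Longrightarrow> ends X e \<subseteq> mverts X"
    and card_ends: "e \<in> medges X \<Longrightarrow> card (ends X e) = 2"
    and no_isolated: "v \<in> mverts X \<Longrightarrow> \<exists>e \<in> medges X. v \<in> ends X e"

text \<open>
  Simple undirected graphs are symmetric, irreflexive arc relations, i.e. instances of
  \<^locale>\<open>pair_bidirected_digraph\<close>, which imposes no finiteness.
\<close>

definition matching :: "'w set set \<Rightarrow> bool" where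
  "matching M \<longleftrightarrow> (\<forall>f \<in> M. card f = 2) \<and> disjoint M"

definition cluster :: "'w set set \<Rightarrow> ('w \<Rightarrow> 'v) \<Rightarrow> 'v \<Rightarrow> 'w set" where
  "cluster M lab v = {x \<in> \<Union>M. lab x = v}"

locale generalized_truncation = multigraph X
  for X :: "('v, 'e) multigraph" +
  fixes M :: "'w set set"
    and F :: "'e \<Rightarrow> 'w set"
    and lab :: "'w \<Rightarrow> 'v"
    and con :: "'v \<Rightarrow> 'w pair_pre_digraph"
    and Y :: "'w pair_pre_digraph"
  assumes matching_M: "matching M"
    and bij_F: "bij_betw F (medges X) M"
    and labelling: "e \<in> medges X \<Longrightarrow> bij_betw lab (F e) (ends X e)"
    and con_graph: "v \<in> mverts X \<Longrightarrow> pair_bidirected_digraph (con v)"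
    and con_verts: "v \<in> mverts X \<Longrightarrow> pverts (con v) = cluster M lab v"
    and Y_eq: "Y = \<lparr> pverts = \<Union>M \<union> (\<Union>v \<in> mverts X. pverts (con v)),
                     parcs = {(x, y). {x, y} \<in> M} \<union> (\<Union>v \<in> mverts X. parcs (con v)) \<rparr>"

text \<open>The label set of a vertex \<^term>\<open>f\<close> of the auxiliary graph is \<^term>\<open>lab ` f\<close>.\<close>

definition aux_graph :: "'w set set \<Rightarrow> ('w \<Rightarrow> 'v) \<Rightarrow> 'w set pair_pre_digraph" where
  "aux_graph M lab = \<lparr> pverts = M,
     parcs = {(f, g). f \<in> M \<and> g \<in> M \<and> f \<noteq> g \<and> lab ` f \<inter> lab ` g \<noteq> {}} \<rparr>"

definition projection ::
    "'w set set \<Rightarrow> ('w \<Rightarrow> 'v) \<Rightarrow> 'w pair_pre_digraph \<Rightarrow> 'w set pair_pre_digraph" where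
  "projection M lab Y = \<lparr> pverts = pverts (aux_graph M lab),
     parcs = {(f, g) \<in> parcs (aux_graph M lab). \<exists>x \<in> f. \<exists>y \<in> g. (x, y) \<in> parcs Y} \<rparr>"

context generalized_truncation
begin

lemma pverts_Y: "pverts Y = \<Union>M"
  using con_verts by (auto simp: Y_eq cluster_def)

lemma graph_Y: "pair_bidirected_digraph Y"
proof -
  have M2: "x \<noteq> y" if "{x, y} \<in> M" for x y
    using that matching_M by (auto simp: matching_def)
  have con: "x \<in> \<Union>M \<and> y \<in> \<Union>M \<and> x \<noteq> y \<and> (y, x) \<in> parcs (con v)"
    if v: "v \<in> mverts X" and a: "(x, y) \<in> parcs (con v)" for x y v
  proof -
    interpret c: pair_bidirected_digraph "con v" using con_graph[OF v] .
    have "x \<in> pverts (con v)" "y \<in> pverts (con v)" using a by (auto dest: c.wellformed')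
    moreover have "x \<noteq> y" using c.pair_no_loops[OF a] by simp
    moreover have "(y, x) \<in> parcs (con v)"
      using c.pair_sym_arcs a by (auto simp: symmetric_def dest: symD)
    ultimately show ?thesis using con_verts[OF v] by (auto simp: cluster_def)
  qed
  have arc: "x \<in> \<Union>M \<and> y \<in> \<Union>M \<and> x \<noteq> y \<and> (y, x) \<in> parcs Y" if a: "(x, y) \<in> parcs Y" for x y
  proof (cases "{x, y} \<in> M")
    case True
    then show ?thesis using M2[OF True] by (auto simp: Y_eq insert_commute)
  next
    case False
    then obtain v where "v \<in> mverts X" "(x, y) \<in> parcs (con v)"
      using a by (auto simp: Y_eq)
    then show ?thesis using con[of v x y] by (auto simp: Y_eq)
  qed
  show ?thesis
  proof
    show "symmetric (with_proj Y)"
      unfolding symmetric_def by (rule symI) (use arc in auto)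
  qed (use arc pverts_Y in fastforce)+
qed

text \<open>
  Requiring adjacency in the auxiliary graph does not remove any edge from the projection.
\<close>

lemma projection_arcs_iff:
  assumes "f \<in> M" "g \<in> M" "f \<noteq> g"
  shows "(f, g) \<in> parcs (projection M lab Y) \<longleftrightarrow> (\<exists>x \<in> f. \<exists>y \<in> g. (x, y) \<in> parcs Y)"
proof
  assume "\<exists>x \<in> f. \<exists>y \<in> g. (x, y) \<in> parcs Y"
  then obtain x y where xy: "x \<in> f" "y \<in> g" "(x, y) \<in> parcs Y" by blast
  have "{x, y} \<notin> M"
  proof
    assume "{x, y} \<in> M"
    moreover have "a = b" if "a \<in> M" "b \<in> M" "z \<in> a" "z \<in> b" for a b z
      using that matching_M unfolding matching_def disjoint_def by blast
    ultimately have "{x, y} = f" "{x, y} = g" using assms xy by blast+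
    then show False using assms by simp
  qed
  then obtain v where v: "v \<in> mverts X" "(x, y) \<in> parcs (con v)"
    using xy by (auto simp: Y_eq)
  interpret c: pair_bidirected_digraph "con v" using con_graph[OF v(1)] .
  have "x \<in> pverts (con v)" "y \<in> pverts (con v)" using v(2) by (auto dest: c.wellformed')
  then have "lab x = lab y" using con_verts[OF v(1)] by (auto simp: cluster_def)
  then have "lab ` f \<inter> lab ` g \<noteq> {}" using xy by blast
  then show "(f, g) \<in> parcs (projection M lab Y)"
    using assms xy by (auto simp: projection_def aux_graph_def)
qed (auto simp: projection_def)

lemma spanning_projection: "spanning (projection M lab Y) (aux_graph M lab)"
  unfolding spanning_def subgraph_def compatible_def wf_digraph_def
  by (auto simp: projection_def aux_graph_def)

lemma graph_projection: "pair_bidirected_digraph (projection M lab Y)"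
proof -
  interpret Y: pair_bidirected_digraph Y by (rule graph_Y)
  have s: "(y, x) \<in> parcs Y" if "(x, y) \<in> parcs Y" for x y
    using Y.pair_sym_arcs that by (auto simp: symmetric_def dest: symD)
  show ?thesis
  proof
    show "symmetric (with_proj (projection M lab Y))"
      unfolding symmetric_def
      by (rule symI) (use s in \<open>auto simp: projection_def aux_graph_def\<close>)
  qed (auto simp: projection_def aux_graph_def)
qed

end

end

theory Submission
  imports Defs
begin

text \<open>The projection is what remains of \<open>Y\<close> when every edge of \<open>M\<close>
  is contracted to a point. Since these edges belong to \<open>Y\<close> and partition its vertices,
  contraction neither joins nor separates components. Walks in \<open>Y\<close> project to walks by
  replacing each vertex with its matching edge (\<open>reachable_projection_if_reachable\<close>);
  walks in the projection lift by inserting matching edges where needed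
  (\<open>reachable_if_reachable_projection\<close>). Because both graphs are symmetric,
  connectedness amounts to directed reachability between all pairs on a nonempty vertex set.\<close>

lemma (in pair_bidirected_digraph) connected_iff_reachable:
  "Digraph_Component.connected (with_proj G) \<longleftrightarrow>
    pverts G \<noteq> {} \<and> (\<forall>u \<in> pverts G. \<forall>v \<in> pverts G. u \<rightarrow>\<^sup>*\<^bsub>with_proj G\<^esub> v)"
  unfolding connected_def strongly_connected_def
  by (simp add: reachable_mk_symmetric_eq[OF pair_sym_arcs])

context generalized_truncation
begin

lemma matching_edge_nonempty: "f \<in> M \<Longrightarrow> f \<noteq> {}"
  using matching_M by (auto simp: matching_def)

lemma matching_edge_unique:
  assumes "f \<in> M" "g \<in> M" "x \<in> f" "x \<in> g"
  shows "f = g"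
  using assms matching_M unfolding matching_def disjoint_def by blast

lemma reachable_within_matching_edge:
  assumes "f \<in> M" "x \<in> f" "y \<in> f"
  shows "x \<rightarrow>\<^sup>*\<^bsub>with_proj Y\<^esub> y"
proof -
  interpret Y: pair_bidirected_digraph Y by (rule graph_Y)
  show ?thesis
  proof (cases "x = y")
    case True
    then show ?thesis using assms pverts_Y by auto
  next
    case False
    moreover have "card f = 2" using assms(1) matching_M by (auto simp: matching_def)
    ultimately have "f = {x, y}" using assms(2,3) by (auto simp: card_2_iff)
    then have "(x, y) \<in> parcs Y" using assms(1) by (auto simp: Y_eq)
    then show ?thesis by (intro Y.reachable_adjI) simp
  qed
qed

text \<open>Induction along the walk in \<open>Y\<close>: each arc either stays inside one matching
  edge, where the projected walk stands still, or passes between two, giving an arc of the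
  projection. \<open>g\<close> varies because it is the matching edge containing the current
  endpoint.\<close>

lemma reachable_projection_if_reachable:
  assumes "x \<rightarrow>\<^sup>*\<^bsub>with_proj Y\<^esub> y" "f \<in> M" "x \<in> f" "g \<in> M" "y \<in> g"
  shows "f \<rightarrow>\<^sup>*\<^bsub>with_proj (projection M lab Y)\<^esub> g"
proof -
  interpret Y: pair_bidirected_digraph Y by (rule graph_Y)
  interpret P: pair_bidirected_digraph "projection M lab Y" by (rule graph_projection)
  have verts_P: "pverts (projection M lab Y) = M"
    by (simp add: projection_def aux_graph_def)
  from assms show ?thesis
  proof (induction arbitrary: g rule: Y.reachable_induct)
    case base
    then show ?case using matching_edge_unique verts_P by auto
  next
    case (step y z)
    from step.hyps(2) have "y \<in> \<Union>M" using Y.adj_in_verts(1) pverts_Y by auto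
    then obtain h where h: "h \<in> M" "y \<in> h" by blast
    have f_h: "f \<rightarrow>\<^sup>*\<^bsub>with_proj (projection M lab Y)\<^esub> h" using step h by blast
    show ?case
    proof (cases "h = g")
      case True
      then show ?thesis using f_h by simp
    next
      case False
      \<comment> \<open>\<open>projection_arcs_iff\<close> supplies the adjacency of
        \<open>h\<close> and \<open>g\<close> in the auxiliary graph: an arc between distinct
        matching edges comes from a constituent, so its ends share a label.\<close>
      then have "(h, g) \<in> parcs (projection M lab Y)"
        using projection_arcs_iff h step by auto
      then show ?thesis using P.reachable_adj_trans[OF f_h] by simp
    qed
  qed
qed

text \<open>An arc of the projection provides an arc of \<open>Y\<close> between some ends of the
  two matching edges, not necessarily the ends wanted; any mismatch is repaired by crossing a
  matching edge.\<close>

lemma reachable_if_reachable_projection: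
  assumes "f \<rightarrow>\<^sup>*\<^bsub>with_proj (projection M lab Y)\<^esub> g" "x \<in> f" "y \<in> g"
  shows "x \<rightarrow>\<^sup>*\<^bsub>with_proj Y\<^esub> y"
proof -
  interpret Y: pair_bidirected_digraph Y by (rule graph_Y)
  interpret P: pair_bidirected_digraph "projection M lab Y" by (rule graph_projection)
  from assms show ?thesis
  proof (induction arbitrary: y rule: P.reachable_induct)
    case base
    then have "f \<in> M" by (simp add: projection_def aux_graph_def)
    then show ?case using base reachable_within_matching_edge by blast
  next
    case (step h g)
    then obtain a b where ab: "g \<in> M" "a \<in> h" "b \<in> g" "(a, b) \<in> parcs Y"
      by (auto simp: projection_def aux_graph_def)
    \<comment> \<open>The induction hypothesis covers every end of \<open>h\<close>, so it can be
      used at the end \<open>a\<close> from which the arc to \<open>g\<close> leaves.\<close>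
    have "x \<rightarrow>\<^sup>*\<^bsub>with_proj Y\<^esub> a" using step ab by blast
    then have "x \<rightarrow>\<^sup>*\<^bsub>with_proj Y\<^esub> b"
      by (rule Y.reachable_adj_trans) (use ab in simp)
    moreover have "b \<rightarrow>\<^sup>*\<^bsub>with_proj Y\<^esub> y"
      using reachable_within_matching_edge ab step.prems by blast
    ultimately show ?case by (rule Y.reachable_trans)
  qed
qed

end

theorem theorem3p1:
  fixes X :: "('v, 'e) multigraph"
    and M :: "'w set set"
    and F :: "'e \<Rightarrow> 'w set"
    and lab :: "'w \<Rightarrow> 'v"
    and con :: "'v \<Rightarrow> 'w pair_pre_digraph"
    and Y :: "'w pair_pre_digraph"
  assumes "generalized_truncation X M F lab con Y"
  shows "Digraph_Component.connected (with_proj Y) \<longleftrightarrow>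
    Digraph_Component.connected (with_proj (projection M lab Y))"
proof -
  interpret generalized_truncation X M F lab con Y by (rule assms)
  interpret Y: pair_bidirected_digraph Y by (rule graph_Y)
  interpret P: pair_bidirected_digraph "projection M lab Y" by (rule graph_projection)
  have verts_P: "pverts (projection M lab Y) = M"
    by (simp add: projection_def aux_graph_def)
  \<comment> \<open>Connectedness includes having a vertex, so the two vertex sets must be empty
    together.\<close>
  have nonempty: "\<Union>M \<noteq> {} \<longleftrightarrow> M \<noteq> {}" using matching_edge_nonempty by blast
  have "(\<forall>x \<in> \<Union>M. \<forall>y \<in> \<Union>M. x \<rightarrow>\<^sup>*\<^bsub>with_proj Y\<^esub> y) \<longleftrightarrow>
    (\<forall>f \<in> M. \<forall>g \<in> M. f \<rightarrow>\<^sup>*\<^bsub>with_proj (projection M lab Y)\<^esub> g)" (is "?L \<longleftrightarrow> ?R")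
  proof
    assume L: ?L
    show ?R
    proof (intro ballI)
      fix f g assume fg: "f \<in> M" "g \<in> M"
      then obtain x y where "x \<in> f" "y \<in> g" using matching_edge_nonempty by blast
      then show "f \<rightarrow>\<^sup>*\<^bsub>with_proj (projection M lab Y)\<^esub> g"
        using L fg reachable_projection_if_reachable by blast
    qed
  next
    assume ?R
    then show ?L using reachable_if_reachable_projection by blast
  qed
  then show ?thesis
    unfolding Y.connected_iff_reachable P.connected_iff_reachable pverts_Y verts_P
    using nonempty by simp
qed

end
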